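(* Let $q$ and $n$ be positive integers and let $\delta=\lceil \log_2 q\rceil$. In the cell-probe model with $w$ bits per cell, for any randomised algorithm solving the online convolution problem (with parameters $q$ and $n$), there exist instances such that the expected amortised time per arriving value is $\Omega\left(\frac{\delta}{w}\log n\right)$.
   Context: Online convolution problem: a vector $F\in[q]^n$ is fixed (known in advance), where $[q]=\{0,\dots,q-1\}$. Numbers from $[q]$ arrive one at a time in a stream. For each arriving number, before the next number arrives, the algorithm must output the inner product modulo $q$ of $F$ with the vector consisting of the $n$ most recent numbers of the stream (initially the stream window is filled with zeros). Cell-probe model: memory consists of cells of $w$ bits each (with $w$ large enough, at least of order $\log n$, that a cell can hold the address of any cell); computation is free and the cost (time) is the number of cells read or written (cell probes). *)

theory Defs
  imports "HOL-Probability.Probability"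
begin

text \<open>\<open>words q n\<close> is \<open>[q]\<^sup>n\<close> with \<open>[q] = {0, \<dots>, q - 1}\<close>.\<close>

definition words :: "nat \<Rightarrow> nat \<Rightarrow> nat list set" where
  "words q n = {xs. length xs = n \<and> set xs \<subseteq> {..<q}}"


subsection \<open>Online convolution\<close>

text \<open>The \<open>n\<close> most recent numbers, oldest first, after the numbers \<open>xs\<close> have arrived
  (the head of \<open>xs\<close> arrived first).  The window initially holds zeros.\<close>

definition window :: "nat \<Rightarrow> nat list \<Rightarrow> nat list" where
  "window n xs = drop (length xs) (replicate n 0 @ xs)"

definition inner_mod :: "nat \<Rightarrow> nat list \<Rightarrow> nat list \<Rightarrow> nat" where
  "inner_mod q F S = (\<Sum>i<length F. F ! i * S ! i) mod q"

definition convolution_outputs :: "nat \<Rightarrow> nat list \<Rightarrow> nat list \<Rightarrow> nat list" where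
  "convolution_outputs q F xs =
     map (\<lambda>t. inner_mod q F (window (length F) (take (Suc t) xs))) [0..<length xs]"


subsection \<open>The cell-probe model\<close>

type_synonym memory = "nat \<Rightarrow> nat"

text \<open>The processing of one arriving number is an adaptive decision tree: the branch taken after
  a read depends on the contents of the cell, and computation between probes costs nothing.
  \<open>Return y\<close> ends the processing with output \<open>y\<close>.\<close>

datatype probe_tree =
    Return nat
  | Read nat "nat \<Rightarrow> probe_tree"
  | Write nat nat probe_tree

text \<open>The result consists of the output, the number of cell probes and the final memory.\<close>

primrec exec :: "probe_tree \<Rightarrow> memory \<Rightarrow> nat \<times> nat \<times> memory" where
  "exec (Return y) mem = (y, 0, mem)"
| "exec (Read a k) mem = (case exec (k (mem a)) mem of (y, c, mem') \<Rightarrow> (y, Suc c, mem'))"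
| "exec (Write a v p) mem = (case exec p (mem(a := v)) of (y, c, mem') \<Rightarrow> (y, Suc c, mem'))"

text \<open>Cells hold \<open>w\<close> bits, and a cell can hold the address of any cell: contents and addresses
  are both numbers below \<open>2 ^ w\<close>.\<close>

primrec wf_tree :: "nat \<Rightarrow> probe_tree \<Rightarrow> bool" where
  "wf_tree w (Return y) \<longleftrightarrow> True"
| "wf_tree w (Read a k) \<longleftrightarrow> a < 2 ^ w \<and> (\<forall>v<2 ^ w. wf_tree w (k v))"
| "wf_tree w (Write a v p) \<longleftrightarrow> a < 2 ^ w \<and> v < 2 ^ w \<and> wf_tree w p"

text \<open>A deterministic algorithm.  The initial memory is arbitrary, which accounts for free
  preprocessing of the fixed vector.  Nothing but the memory survives from one arrival to the
  next.  The tree \<open>step A t x\<close> run when the number \<open>x\<close> arrives may depend on the arrival index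
  \<open>t\<close>; so a distribution over deterministic algorithms also covers algorithms that toss fresh
  coins at every arrival.\<close>

record algorithm =
  init :: memory
  step :: "nat \<Rightarrow> nat \<Rightarrow> probe_tree"

definition wf_algorithm :: "nat \<Rightarrow> nat \<Rightarrow> algorithm \<Rightarrow> bool" where
  "wf_algorithm w q A \<longleftrightarrow>
     (\<forall>a<2 ^ w. init A a < 2 ^ w) \<and> (\<forall>t. \<forall>x<q. wf_tree w (step A t x))"

text \<open>Outputs and total number of probes when the given numbers arrive at times
  \<open>t, t + 1, \<dots>\<close>.\<close>

primrec run :: "(nat \<Rightarrow> nat \<Rightarrow> probe_tree) \<Rightarrow> nat list \<Rightarrow> nat \<Rightarrow> memory \<Rightarrow> nat list \<times> nat" where
  "run st [] t mem = ([], 0)"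
| "run st (x # xs) t mem =
     (case exec (st t x) mem of (y, c, mem') \<Rightarrow>
        (case run st xs (Suc t) mem' of (ys, d) \<Rightarrow> (y # ys, c + d)))"

definition outputs :: "algorithm \<Rightarrow> nat list \<Rightarrow> nat list" where
  "outputs A xs = fst (run (step A) xs 0 (init A))"

definition probes :: "algorithm \<Rightarrow> nat list \<Rightarrow> nat" where
  "probes A xs = snd (run (step A) xs 0 (init A))"

definition solves_convolution :: "nat \<Rightarrow> nat list \<Rightarrow> algorithm \<Rightarrow> bool" where
  "solves_convolution q F A \<longleftrightarrow>
     (\<forall>xs. set xs \<subseteq> {..<q} \<longrightarrow> outputs A xs = convolution_outputs q F xs)"


subsection \<open>Randomised algorithms\<close>

text \<open>A randomised algorithm is a probability distribution over deterministic ones.  Its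
  \<open>\<sigma>\<close>-algebra is arbitrary, as long as the number of probes on every stream is a random variable.\<close>

definition randomised_algorithm :: "nat \<Rightarrow> nat \<Rightarrow> algorithm measure \<Rightarrow> bool" where
  "randomised_algorithm w q M \<longleftrightarrow>
     prob_space M \<and> (\<forall>A\<in>space M. wf_algorithm w q A) \<and>
     (\<forall>xs. set xs \<subseteq> {..<q} \<longrightarrow> (\<lambda>A. probes A xs) \<in> measurable M (count_space UNIV))"

text \<open>The family \<open>\<A>\<close> has one member for each \<open>F\<close>, since \<open>F\<close> is known in advance.\<close>

definition solves_online_convolution ::
    "nat \<Rightarrow> nat \<Rightarrow> nat \<Rightarrow> (nat list \<Rightarrow> algorithm measure) \<Rightarrow> bool" where
  "solves_online_convolution w q n \<A> \<longleftrightarrow>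
     (\<forall>F\<in>words q n. randomised_algorithm w q (\<A> F) \<and> (AE A in \<A> F. solves_convolution q F A))"

definition expected_amortised_time :: "algorithm measure \<Rightarrow> nat list \<Rightarrow> ennreal" where
  "expected_amortised_time M xs = (\<integral>\<^sup>+ A. of_nat (probes A xs) \<partial>M) / of_nat (length xs)"

end

theory Submission
  imports Defs
begin

text \<open>The argument measures information transfer (Patrascu and Demaine).  Let \<open>F\<close> give weight 1 to
  the numbers whose age is a power of two, and feed a uniformly random stream.  Take a dyadic
  interval of \<open>2l\<close> arrivals and fix all inputs outside its first half.  The outputs in the second
  half determine the \<open>q ^ l\<close> possible first halves, because the only power of two in \<open>[l, 2l)\<close> is
  \<open>l\<close> itself, so that the last disagreement of two first halves shows up \<open>l\<close> steps later.  All that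
  the second half learns about the first comes from cells changed in the first half and read in
  the second; their addresses and contents take \<open>2w\<close> bits each, so on average at least
  \<open>l log q / (8w)\<close> such cells are needed.  A read is charged to at most one dyadic interval; summing
  over the about \<open>m / (2l)\<close> intervals of each of the about \<open>log n\<close> lengths gives the bound on the
  average of the streams, for every correct deterministic algorithm and so for distributions.\<close>


section \<open>Words\<close>

lemma finite_words [simp]: "finite (words q n)"
  using finite_lists_length_eq[of "{..<q}" n] by (simp add: words_def conj_commute)

lemma card_words [simp]: "card (words q n) = q ^ n"
  using card_lists_length_eq[of "{..<q}" n] by (simp add: words_def conj_commute)

lemma words_nth: "xs \<in> words q n \<Longrightarrow> i < n \<Longrightarrow> xs ! i < q"
  unfolding words_def using nth_mem by fastforce

lemma words_append: "u \<in> words q a \<Longrightarrow> v \<in> words q b \<Longrightarrow> u @ v \<in> words q (a + b)"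
  by (auto simp: words_def)

lemma sum_words_append:
  "(\<Sum>xs\<in>words q (a + b). f xs) = (\<Sum>u\<in>words q a. \<Sum>v\<in>words q b. f (u @ v))"
proof -
  have "(\<Sum>xs\<in>words q (a + b). f xs) = (\<Sum>(u, v)\<in>words q a \<times> words q b. f (u @ v))"
    by (rule sum.reindex_bij_witness[where i = "\<lambda>(u, v). u @ v" and j = "\<lambda>xs. (take a xs, drop a xs)"])
       (auto simp: words_def dest: in_set_takeD in_set_dropD)
  then show ?thesis by (simp add: sum.cartesian_product)
qed


section \<open>Executions\<close>

text \<open>Only reads are charged in the argument, since writing a cell reveals nothing of its
  earlier content.\<close>

primrec reads :: "probe_tree \<Rightarrow> memory \<Rightarrow> nat set" where
  "reads (Return y) mem = {}"
| "reads (Read a k) mem = insert a (reads (k (mem a)) mem)"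
| "reads (Write a v p) mem = reads p (mem(a := v))"

lemma finite_reads [simp]: "finite (reads p mem)"
  by (induction p arbitrary: mem) auto

lemma card_reads_le: "card (reads p mem) \<le> fst (snd (exec p mem))"
proof (induction p arbitrary: mem)
  case (Read a k)
  have "card (reads (Read a k) mem) \<le> Suc (card (reads (k (mem a)) mem))"
    by (simp add: card_insert_le_m1 card_insert_if)
  then show ?case using Read[OF rangeI, of "mem a" mem] by (simp add: case_prod_beta)
next
  case (Write a v p)
  show ?case using Write[of "mem(a := v)"] by (simp add: case_prod_beta del: fun_upd_apply)
qed simp

lemma wf_tree_exec:
  assumes "wf_tree w p" "\<forall>a<2 ^ w. mem a < 2 ^ w"
  shows "reads p mem \<subseteq> {..<2 ^ w} \<and> (\<forall>a<2 ^ w. snd (snd (exec p mem)) a < 2 ^ w)"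
  using assms
proof (induction p arbitrary: mem)
  case (Read a k)
  then show ?case using Read.IH[OF rangeI, of "mem a" mem] by (simp add: case_prod_beta)
next
  case (Write a v p)
  then show ?case using Write.IH[of "mem(a := v)"] by (simp add: case_prod_beta)
qed simp

text \<open>The two executions follow the same path until a common read meets different contents.
  Writes along a common path store the same value in both memories, so a cell that differs
  afterwards has kept its original content in each.\<close>

lemma exec_agree:
  "(\<exists>a\<in>reads p mem \<inter> reads p mem'. mem a \<noteq> mem' a) \<or>
   fst (exec p mem) = fst (exec p mem') \<and>
   (\<forall>a. snd (snd (exec p mem)) a = snd (snd (exec p mem')) a \<or>
        snd (snd (exec p mem)) a = mem a \<and> snd (snd (exec p mem')) a = mem' a)"
proof (induction p arbitrary: mem mem')
  case (Read a k)
  show ?case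
  proof (cases "mem a = mem' a")
    case True
    show ?thesis using Read.IH[OF rangeI, of "mem a" mem mem'] True by (auto simp: case_prod_beta)
  qed auto
next
  case (Write a v p)
  define m m' where "m = mem(a := v)" and "m' = mem'(a := v)"
  \<comment> \<open>The common write can erase a difference but never creates one, so a difference
    found later in the tree refers back to \<open>mem\<close> and \<open>mem'\<close>.\<close>
  have upd: "m b \<noteq> m' b \<Longrightarrow> mem b \<noteq> mem' b" "m b = m' b \<or> m b = mem b \<and> m' b = mem' b" for b
    by (auto simp: m_def m'_def split: if_splits)
  show ?case using Write.IH[of m m'] upd
    by (simp add: case_prod_beta m_def[symmetric] m'_def[symmetric]) metis
qed auto

section \<open>The memory as a function of time\<close>

primrec mem_at :: "algorithm \<Rightarrow> nat list \<Rightarrow> nat \<Rightarrow> memory" where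
  "mem_at A xs 0 = init A"
| "mem_at A xs (Suc t) = snd (snd (exec (step A t (xs ! t)) (mem_at A xs t)))"

lemma run_from:
  assumes "t \<le> length xs"
  shows "run (step A) (drop t xs) t (mem_at A xs t) =
    (map (\<lambda>s. fst (exec (step A s (xs ! s)) (mem_at A xs s))) [t..<length xs],
     \<Sum>s=t..<length xs. fst (snd (exec (step A s (xs ! s)) (mem_at A xs s))))"
  using assms
proof (induction rule: inc_induct)
  case base
  then show ?case by simp
next
  case (step n)
  then show ?case
    by (simp add: Cons_nth_drop_Suc[symmetric] case_prod_beta upt_conv_Cons
        sum.atLeast_Suc_lessThan)
qed

lemma outputs_nth:
  "t < length xs \<Longrightarrow> outputs A xs ! t = fst (exec (step A t (xs ! t)) (mem_at A xs t))"
  using run_from[of 0 xs A] by (simp add: outputs_def)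

lemma probes_eq:
  "probes A xs = (\<Sum>t<length xs. fst (snd (exec (step A t (xs ! t)) (mem_at A xs t))))"
  using run_from[of 0 xs A] by (simp add: probes_def lessThan_atLeast0)

lemma mem_at_cong: "(\<And>s. s < t \<Longrightarrow> xs ! s = ys ! s) \<Longrightarrow> mem_at A xs t = mem_at A ys t"
  by (induction t) auto

lemma mem_at_bounded:
  assumes "wf_algorithm w q A" "xs \<in> words q m" "t \<le> m"
  shows "\<forall>a<2 ^ w. mem_at A xs t a < 2 ^ w"
  using assms(3)
proof (induction t)
  case 0
  then show ?case using assms(1) by (simp add: wf_algorithm_def)
next
  case (Suc t)
  have "wf_tree w (step A t (xs ! t))"
    using assms(1) words_nth[OF assms(2)] Suc.prems by (simp add: wf_algorithm_def)
  then show ?case using Suc wf_tree_exec by simp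
qed


section \<open>Information transfer\<close>

text \<open>The reads in the second half of \<open>[b, b + 2l)\<close> of cells whose content was fixed in the first
  half.  A cell counts as updated only if its content differs, so overwriting it with the same
  value, or changing it and changing it back within the first half, does not matter.\<close>

definition transfer :: "algorithm \<Rightarrow> nat list \<Rightarrow> nat \<Rightarrow> nat \<Rightarrow> (nat \<times> nat) set" where
  "transfer A xs b l = {(t, a). b + l \<le> t \<and> t < b + 2 * l \<and>
     a \<in> reads (step A t (xs ! t)) (mem_at A xs t) \<and>
     mem_at A xs b a \<noteq> mem_at A xs (b + l) a \<and>
     (\<forall>s. b + l \<le> s \<and> s \<le> t \<longrightarrow> mem_at A xs s a = mem_at A xs (b + l) a)}"

text \<open>The message from the first half to the second. Without the read times its elements are
  pairs of \<open>w\<close>-bit numbers, so at most \<open>2 ^ (2 * w)\<close> elements can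
  occur.\<close>

definition transfer_code :: "algorithm \<Rightarrow> nat list \<Rightarrow> nat \<Rightarrow> nat \<Rightarrow> (nat \<times> nat) set" where
  "transfer_code A xs b l = (\<lambda>a. (a, mem_at A xs (b + l) a)) ` snd ` transfer A xs b l"

lemma transferI:
  assumes "b + l \<le> t" "t < b + 2 * l" "a \<in> reads (step A t (xs ! t)) (mem_at A xs t)"
    "mem_at A xs b a \<noteq> mem_at A xs (b + l) a"
    "\<And>s. b + l \<le> s \<Longrightarrow> s \<le> t \<Longrightarrow> mem_at A xs s a = mem_at A xs (b + l) a"
  shows "(t, a) \<in> transfer A xs b l"
  using assms unfolding transfer_def by blast

lemma transferD:
  assumes "(t, a) \<in> transfer A xs b l"
  shows "b + l \<le> t" "t < b + 2 * l" "a \<in> reads (step A t (xs ! t)) (mem_at A xs t)"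
    "mem_at A xs b a \<noteq> mem_at A xs (b + l) a"
    "b + l \<le> s \<Longrightarrow> s \<le> t \<Longrightarrow> mem_at A xs s a = mem_at A xs (b + l) a"
  using assms unfolding transfer_def by blast+

lemma transfer_subset:
  "b + 2 * l \<le> m \<Longrightarrow>
    transfer A xs b l \<subseteq> (SIGMA t:{..<m}. reads (step A t (xs ! t)) (mem_at A xs t))"
  by (auto dest: transferD(2,3))

lemma finite_transfer [simp]: "finite (transfer A xs b l)"
  by (rule finite_subset[OF transfer_subset[OF order_refl]]) simp

lemma card_transfer_code_le: "card (transfer_code A xs b l) \<le> card (transfer A xs b l)"
  unfolding transfer_code_def by (meson card_image_le finite_imageI finite_transfer le_trans)

lemma transfer_code_subset:
  assumes "wf_algorithm w q A" "xs \<in> words q m" "b + 2 * l \<le> m"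
  shows "transfer_code A xs b l \<subseteq> {..<2 ^ w} \<times> {..<2 ^ w}"
proof -
  have "a < 2 ^ w \<and> mem_at A xs (b + l) a < 2 ^ w" if "(t, a) \<in> transfer A xs b l" for t a
  proof -
    have t: "t < m" "b + l \<le> m" and a: "a \<in> reads (step A t (xs ! t)) (mem_at A xs t)"
      using transferD(1-3)[OF that] assms(3) by auto
    have "wf_tree w (step A t (xs ! t))"
      using assms(1) words_nth[OF assms(2)] t by (simp add: wf_algorithm_def)
    then have "reads (step A t (xs ! t)) (mem_at A xs t) \<subseteq> {..<2 ^ w}"
      using wf_tree_exec mem_at_bounded[OF assms(1,2), of t] t by simp
    then have "a < 2 ^ w" using a by auto
    then show ?thesis using mem_at_bounded[OF assms(1,2) t(2)] by simp
  qed
  then show ?thesis by (force simp: transfer_code_def)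
qed

text \<open>The middle \<open>b'\<close> of the longer interval is a multiple of
  \<open>2 ^ Suc k\<close>, the length of the shorter one. As \<open>b'\<close> is at most
  \<open>t\<close>, it is at most the start \<open>b\<close> of the shorter one. The second transfer
  keeps the cell constant from \<open>b'\<close> to \<open>t\<close>, while the first needs
  different contents at \<open>b\<close> and \<open>b + 2 ^ k\<close>.\<close>

lemma dyadic_transfer_disjoint:
  assumes "k < k'" "(t, a) \<in> transfer A xs (i * 2 ^ Suc k) (2 ^ k)"
    "(t, a) \<in> transfer A xs (i' * 2 ^ Suc k') (2 ^ k')"
  shows False
proof -
  define b b' where "b = i * 2 ^ Suc k" and "b' = i' * 2 ^ Suc k' + (2::nat) ^ k'"
  have t: "b + 2 ^ k \<le> t" "t < b + 2 ^ Suc k" "b' \<le> t"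
    and ne: "mem_at A xs b a \<noteq> mem_at A xs (b + 2 ^ k) a"
    using transferD(1,2,4)[OF assms(2)] transferD(1)[OF assms(3)] unfolding b_def b'_def by simp_all
  have eq: "mem_at A xs s a = mem_at A xs b' a" if "b' \<le> s" "s \<le> t" for s
    using transferD(5)[OF assms(3)] that unfolding b'_def by blast
  have "(2::nat) ^ Suc k dvd 2 ^ k'" using assms(1) by (intro le_imp_power_dvd) simp
  moreover have "(2::nat) ^ Suc k dvd 2 ^ Suc k'" using assms(1) by (intro le_imp_power_dvd) simp
  ultimately have "(2::nat) ^ Suc k dvd b'"
    unfolding b'_def by (intro dvd_add dvd_mult)
  then obtain j where j: "b' = j * 2 ^ Suc k" by (metis dvd_def mult.commute)
  have "j * 2 ^ Suc k < (i + 1) * 2 ^ Suc k"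
    using t unfolding b_def j by (simp add: algebra_simps)
  then have "j \<le> i" using mult_less_cancel2[of j "2 ^ Suc k" "i + 1"] by simp
  then have "b' \<le> b" unfolding b_def j by (intro mult_right_mono) simp_all
  then show False using ne eq[of b] eq[of "b + 2 ^ k"] t by simp
qed

lemma sum_card_transfer_le_probes:
  assumes "length xs = m"
  shows "(\<Sum>k<K. \<Sum>i<m div 2 ^ Suc k. card (transfer A xs (i * 2 ^ Suc k) (2 ^ k))) \<le> probes A xs"
proof -
  define I where "I = (SIGMA k:{..<K}. {..<m div 2 ^ Suc k})"
  define T where "T = (\<lambda>(k::nat, i::nat). transfer A xs (i * 2 ^ Suc k) (2 ^ k))"
  define R where "R = (SIGMA t:{..<m}. reads (step A t (xs ! t)) (mem_at A xs t))"
  have disj: "T x \<inter> T y = {}" if "x \<noteq> y" for x y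
  proof (rule ccontr)
    assume "T x \<inter> T y \<noteq> {}"
    then obtain t a where ta: "(t, a) \<in> T x" "(t, a) \<in> T y" by auto
    obtain k i k' i' where xy: "x = (k, i)" "y = (k', i')" by (cases x; cases y)
    have k: "k = k'"
      using ta dyadic_transfer_disjoint[of k k' t a A xs i i']
        dyadic_transfer_disjoint[of k' k t a A xs i' i]
      unfolding xy T_def by (cases k k' rule: linorder_cases) auto
    \<comment> \<open>Intervals of equal length are disjoint, so \<open>t\<close> determines the
      index.\<close>
    have "t div 2 ^ Suc k = i" "t div 2 ^ Suc k = i'"
      using transferD(1,2)[of t a A xs "i * 2 ^ Suc k'" "2 ^ k'"]
        transferD(1,2)[of t a A xs "i' * 2 ^ Suc k'" "2 ^ k'"] ta
      unfolding xy k T_def by (auto simp: algebra_simps intro!: div_nat_eqI)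
    then show False using that xy k by simp
  qed
  have sub: "T x \<subseteq> R" if "x \<in> I" for x
  proof -
    obtain k i where x: "x = (k, i)" by (cases x)
    have "Suc i \<le> m div 2 ^ Suc k" using that unfolding x I_def by simp
    then have "Suc i * 2 ^ Suc k \<le> m"
      by (metis div_times_less_eq_dividend le_trans mult_le_mono1)
    then have "i * 2 ^ Suc k + 2 * 2 ^ k \<le> m" by simp
    then show ?thesis unfolding x T_def R_def using transfer_subset by simp
  qed
  have finR: "finite R" unfolding R_def by auto
  have "(\<Sum>k<K. \<Sum>i<m div 2 ^ Suc k. card (transfer A xs (i * 2 ^ Suc k) (2 ^ k))) =
      (\<Sum>x\<in>I. card (T x))"
    unfolding I_def T_def by (subst sum.Sigma) (auto simp: case_prod_beta)
  also have "\<dots> = card (\<Union>x\<in>I. T x)"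
  proof (rule card_UN_disjoint[symmetric])
    show "\<forall>x\<in>I. \<forall>y\<in>I. x \<noteq> y \<longrightarrow> T x \<inter> T y = {}" using disj by blast
  qed (auto simp: I_def T_def)
  also have "\<dots> \<le> card R" using sub finR by (intro card_mono) auto
  also have "\<dots> = (\<Sum>t<m. card (reads (step A t (xs ! t)) (mem_at A xs t)))"
    unfolding R_def by simp
  also have "\<dots> \<le> probes A xs"
    unfolding probes_eq assms by (intro sum_mono card_reads_le)
  finally show ?thesis .
qed

text \<open>Two runs whose inputs differ only in the first half and whose codes agree stay in step
  throughout the second half: a cell on which they differ there has not been touched since the
  middle.  The first read to tell them apart would hit a cell that one of the runs changed in
  the first half, so this cell belongs to the common code, which lists its content.\<close>

lemma outputs_eq_if_transfer_code_eq:
  assumes len: "length xs = m" "length ys = m" "b + 2 * l \<le> m"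
    and agree: "\<And>s. s < m \<Longrightarrow> s < b \<or> b + l \<le> s \<Longrightarrow> xs ! s = ys ! s"
    and code: "transfer_code A xs b l = transfer_code A ys b l"
    and t: "b + l \<le> t" "t < b + 2 * l"
  shows "outputs A xs ! t = outputs A ys ! t"
proof -
  define M N where "M = mem_at A xs" and "N = mem_at A ys"
  have start: "M b = N b" unfolding M_def N_def using agree len by (intro mem_at_cong) simp
  \<comment> \<open>In each code an address occurs only with that run's content at the middle, so
    equal codes force equal contents.\<close>
  have listed: "M (b + l) a = N (b + l) a"
    if "a \<in> snd ` transfer A xs b l \<union> snd ` transfer A ys b l" for a
  proof -
    have "(a, M (b + l) a) \<in> transfer_code A xs b l \<or> (a, N (b + l) a) \<in> transfer_code A ys b l"
      using that unfolding transfer_code_def M_def N_def by blast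
    then show ?thesis using code unfolding transfer_code_def M_def N_def by blast
  qed
  define inv where "inv t \<longleftrightarrow> (\<forall>a. M t a \<noteq> N t a \<longrightarrow>
    (\<forall>s. b + l \<le> s \<and> s \<le> t \<longrightarrow> M s a = M (b + l) a \<and> N s a = N (b + l) a))" for t
  have lockstep: "fst (exec (step A t (xs ! t)) (M t)) = fst (exec (step A t (ys ! t)) (N t)) \<and>
      inv (Suc t)" if t: "b + l \<le> t" "t < b + 2 * l" and inv: "inv t" for t
  proof -
    define p where "p = step A t (xs ! t)"
    have p: "p = step A t (ys ! t)" using agree[of t] t len by (simp add: p_def)
    have Suc: "M (Suc t) = snd (snd (exec p (M t)))" "N (Suc t) = snd (snd (exec p (N t)))"
      by (simp_all add: M_def N_def p) (simp add: p_def p[symmetric])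
    have no: "M t a = N t a" if a: "a \<in> reads p (M t) \<inter> reads p (N t)" for a
    proof (rule ccontr)
      assume ne: "M t a \<noteq> N t a"
      have const: "M s a = M (b + l) a \<and> N s a = N (b + l) a" if "b + l \<le> s" "s \<le> t" for s
        using inv ne that unfolding inv_def by blast
      have ne': "M (b + l) a \<noteq> N (b + l) a" using const[of t] ne t by simp
      then have "M b a \<noteq> M (b + l) a \<or> N b a \<noteq> N (b + l) a" using start by simp
      moreover have "(t, a) \<in> transfer A xs b l" if "M b a \<noteq> M (b + l) a"
        by (rule transferI) (use t a that const in \<open>unfold M_def p_def, blast+\<close>)
      moreover have "(t, a) \<in> transfer A ys b l" if "N b a \<noteq> N (b + l) a"
        by (rule transferI) (use t a that const in \<open>unfold N_def p, blast+\<close>)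
      ultimately have "(t, a) \<in> transfer A xs b l \<union> transfer A ys b l" by blast
      from imageI[OF this, of snd] have "a \<in> snd ` transfer A xs b l \<union> snd ` transfer A ys b l"
        by (simp only: image_Un snd_conv)
      then show False using listed ne' by blast
    qed
    then have ex: "fst (exec p (M t)) = fst (exec p (N t))"
      "\<And>a. M (Suc t) a = N (Suc t) a \<or> M (Suc t) a = M t a \<and> N (Suc t) a = N t a"
      using exec_agree[of p "M t" "N t"] unfolding Suc by blast+
    \<comment> \<open>A cell that differs after the step kept its content in both runs and so
      differed before; its constancy extends by one step.\<close>
    have "inv (Suc t)"
      unfolding inv_def using ex(2) inv[unfolded inv_def] t(1) by (metis le_Suc_eq order_refl)
    then show ?thesis using ex(1) by (simp add: p_def p[symmetric])
  qed
  have "inv t" if "b + l \<le> t" "t < b + 2 * l" for t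
    using that
  proof (induction t rule: dec_induct)
    case base
    then show ?case by (auto simp: inv_def)
  next
    case (step n)
    then show ?case using \<open>b + l \<le> n\<close> lockstep by simp
  qed
  then show ?thesis using lockstep t len by (simp add: outputs_nth M_def N_def)
qed


section \<open>The hard vector\<close>

text \<open>The entry with index \<open>i\<close> is the weight of the number that arrived \<open>n - Suc i\<close> steps ago.\<close>

definition hard_vector :: "nat \<Rightarrow> nat list" where
  "hard_vector n = map (\<lambda>i. if \<exists>k. n - Suc i = 2 ^ k then 1 else 0) [0..<n]"

lemma hard_vector_in_words: "1 < q \<Longrightarrow> hard_vector n \<in> words q n"
  by (auto simp: words_def hard_vector_def)

lemma mod_add_right_cancel_nat:
  "(x + a) mod q = (y + a) mod q \<longleftrightarrow> x mod q = y mod q" for x y a q :: nat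
proof -
  have "(int x + int a) mod int q = (int y + int a) mod int q \<longleftrightarrow> int x mod int q = int y mod int q"
    by (simp add: mod_eq_dvd_iff)
  then show ?thesis by (simp flip: of_nat_add of_nat_mod)
qed

text \<open>Position \<open>i\<close> of the window is position \<open>Suc t + i\<close> of the
  padded stream. The test separates the padding, where the subtraction would be truncated.\<close>

lemma convolution_outputs_nth:
  assumes "t < length xs"
  shows "convolution_outputs q F xs ! t =
    (\<Sum>i<length F. F ! i * (if t + Suc i < length F then 0 else xs ! (t + Suc i - length F))) mod q"
proof -
  have "window (length F) (take (Suc t) xs) ! i =
      (if t + Suc i < length F then 0 else xs ! (t + Suc i - length F))" if "i < length F" for i
  proof -
    have "window (length F) (take (Suc t) xs) ! i =
        (replicate (length F) 0 @ take (Suc t) xs) ! (Suc t + i)"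
      unfolding window_def using assms by (subst nth_drop) auto
    then show ?thesis using that by (simp add: nth_append)
  qed
  then show ?thesis using assms by (simp add: convolution_outputs_def inner_mod_def)
qed

text \<open>The inputs that may differ have ages between \<open>2 ^ k\<close> and \<open>2 ^ Suc k - 1\<close>, where \<open>2 ^ k\<close> is the
  only power of two.\<close>

lemma hard_vector_recovers:
  assumes xs: "xs \<in> words q m" and ys: "ys \<in> words q m"
    and p: "b \<le> p" "p < b + 2 ^ k" "p + 2 ^ k < m" and n: "2 ^ k < n"
    and agree: "\<And>s. s < m \<Longrightarrow> s < b \<or> p < s \<Longrightarrow> xs ! s = ys ! s"
    and eq: "convolution_outputs q (hard_vector n) xs ! (p + 2 ^ k) =
      convolution_outputs q (hard_vector n) ys ! (p + 2 ^ k)"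
  shows "xs ! p = ys ! p"
proof -
  \<comment> \<open>At time \<open>t\<close> the number that arrived at \<open>p\<close> has age
    \<open>2 ^ k\<close>, and \<open>i0\<close> is the index of its weight 1.\<close>
  define t where "t = p + 2 ^ k"
  define i0 where "i0 = n - Suc (2 ^ k)"
  define g where "g zs i = hard_vector n ! i * (if t + Suc i < n then 0 else zs ! (t + Suc i - n))"
    for zs i
  have len: "length xs = m" "length ys = m" "length (hard_vector n) = n"
    using xs ys by (auto simp: words_def hard_vector_def)
  have i0: "i0 < n" using n by (simp add: i0_def)
  have gi0: "g zs i0 = zs ! p" for zs
  proof -
    have "n - Suc i0 = 2 ^ k" "\<not> t + Suc i0 < n" "t + Suc i0 - n = p"
      using n by (auto simp: i0_def t_def)
    then show ?thesis using i0 by (auto simp: g_def hard_vector_def)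
  qed
  have rest: "g xs i = g ys i" if i: "i < n" "i \<noteq> i0" for i
  proof (cases "hard_vector n ! i = 0 \<or> t + Suc i < n")
    case False
    then obtain j where j: "n - Suc i = 2 ^ j"
      using i by (auto simp: hard_vector_def split: if_splits)
    define s where "s = t + Suc i - n"
    have s: "s + 2 ^ j = t" using False j i unfolding s_def by linarith
    have "j \<noteq> k" using j i n by (auto simp: i0_def)
    \<comment> \<open>A smaller power of two as age gives an arrival after \<open>p\<close>. A
      larger one is at least twice \<open>2 ^ k\<close>, so the arrival precedes \<open>p\<close> by
      at least \<open>2 ^ k\<close> and lies before \<open>b\<close>.\<close>
    then have "s < b \<or> p < s"
    proof (cases j k rule: linorder_cases)
      case less
      then have "(2::nat) ^ j < 2 ^ k" by simp
      then show ?thesis using s unfolding t_def by linarith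
    next
      case greater
      then have "(2::nat) ^ Suc k \<le> 2 ^ j" by (intro power_increasing) auto
      then show ?thesis using s p unfolding t_def by simp
    qed simp
    moreover have "s < m" using s p unfolding t_def by simp
    ultimately show ?thesis using agree unfolding g_def s_def by simp
  qed (auto simp: g_def)
  have "convolution_outputs q (hard_vector n) zs ! t = (\<Sum>i<n. g zs i) mod q"
    if "length zs = m" for zs
    using convolution_outputs_nth[of t zs q "hard_vector n"] that p(3) unfolding len t_def g_def by simp
  then have "(\<Sum>i<n. g xs i) mod q = (\<Sum>i<n. g ys i) mod q"
    using eq len unfolding t_def by simp
  then have "(xs ! p + (\<Sum>i\<in>{..<n} - {i0}. g xs i)) mod q =
      (ys ! p + (\<Sum>i\<in>{..<n} - {i0}. g ys i)) mod q"
    using i0 by (simp add: sum.remove[of "{..<n}" i0] gi0)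
  moreover have "(\<Sum>i\<in>{..<n} - {i0}. g xs i) = (\<Sum>i\<in>{..<n} - {i0}. g ys i)"
    using rest by (intro sum.cong) auto
  ultimately have "xs ! p mod q = ys ! p mod q"
    by (simp only: mod_add_right_cancel_nat)
  then show ?thesis using words_nth[OF xs, of p] words_nth[OF ys, of p] p by simp
qed

text \<open>Equal codes would make all outputs of the second half agree. After the last position
  where the first halves differ all inputs agree, so the output \<open>2 ^ k\<close> steps later
  recovers the number there, a contradiction.\<close>

lemma transfer_code_inj:
  assumes sol: "solves_convolution q (hard_vector n) A"
    and u: "u \<in> words q b" and v: "v \<in> words q c" and c: "2 ^ k \<le> c" and n: "2 ^ k < n"
  shows "inj_on (\<lambda>x. transfer_code A (u @ x @ v) b (2 ^ k)) (words q (2 ^ k))"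
proof (rule inj_onI, rule ccontr)
  fix x y
  assume x: "x \<in> words q (2 ^ k)" and y: "y \<in> words q (2 ^ k)"
    and code: "transfer_code A (u @ x @ v) b (2 ^ k) = transfer_code A (u @ y @ v) b (2 ^ k)"
    and "x \<noteq> y"
  define l m where "l = (2::nat) ^ k" and "m = b + (l + c)"
  have len: "length u = b" "length v = c" "length x = l" "length y = l"
    using u v x y by (auto simp: words_def l_def)
  define xs ys where "xs = u @ x @ v" and "ys = u @ y @ v"
  have xys: "xs \<in> words q m" "ys \<in> words q m"
    using u v x y unfolding xs_def ys_def m_def l_def by (auto intro!: words_append)
  then have len': "length xs = m" "length ys = m" by (auto simp: words_def)
  define D where "D = {i. i < l \<and> x ! i \<noteq> y ! i}"
  have D: "finite D" "D \<noteq> {}"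
    using \<open>x \<noteq> y\<close> len by (auto simp: D_def list_eq_iff_nth_eq)
  define i where "i = Max D"
  have i: "i < l" "x ! i \<noteq> y ! i" using Max_in[OF D] by (auto simp: D_def i_def)
  have above: "x ! j = y ! j" if "i < j" "j < l" for j
  proof (rule ccontr)
    assume "x ! j \<noteq> y ! j"
    then have "j \<le> i" unfolding i_def using that D by (intro Max_ge) (simp_all add: D_def)
    then show False using that by simp
  qed
  have agree: "xs ! s = ys ! s" if "s < m" "s < b \<or> b + i < s" for s
    using that above[of "s - b"] len by (auto simp: xs_def ys_def nth_append)
  have lc: "l \<le> c" using c by (simp add: l_def)
  have "outputs A xs ! (b + i + l) = outputs A ys ! (b + i + l)"
    using code i lc len' agree
    by (intro outputs_eq_if_transfer_code_eq[where b = b and l = l and m = m])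
       (auto simp: xs_def ys_def l_def[symmetric] m_def)
  moreover have "outputs A zs = convolution_outputs q (hard_vector n) zs" if "zs \<in> words q m" for zs
    using sol that by (auto simp: solves_convolution_def words_def)
  ultimately have eq: "convolution_outputs q (hard_vector n) xs ! (b + i + l) =
      convolution_outputs q (hard_vector n) ys ! (b + i + l)" using xys by simp
  have "xs ! (b + i) = ys ! (b + i)"
    by (rule hard_vector_recovers[OF xys, where b = b and k = k and n = n])
       (use i lc n agree eq in \<open>auto simp: l_def[symmetric] m_def\<close>)
  then show False using i len by (simp add: xs_def ys_def nth_append)
qed


section \<open>Counting\<close>

lemma card_small_subsets_le:
  assumes "finite U"
  shows "card {S. S \<subseteq> U \<and> card S \<le> j} \<le> (\<Sum>i\<le>j. card U ^ i)"
proof -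
  have "{S. S \<subseteq> U \<and> card S \<le> j} = (\<Union>i\<le>j. {S. S \<subseteq> U \<and> card S = i})" by auto
  then have "card {S. S \<subseteq> U \<and> card S \<le> j} \<le> (\<Sum>i\<le>j. card {S. S \<subseteq> U \<and> card S = i})"
    by (simp add: card_UN_le)
  also have "\<dots> \<le> (\<Sum>i\<le>j. card U ^ i)"
  proof (rule sum_mono)
    fix i
    show "card {S. S \<subseteq> U \<and> card S = i} \<le> card U ^ i"
      using n_subsets[OF assms, of i] binomial_le_pow[of i "card U"]
      by (cases "i \<le> card U") (auto simp: binomial_eq_0)
  qed
  finally show ?thesis .
qed

lemma sum_powers_le:
  assumes "2 \<le> (V::nat)"
  shows "(\<Sum>i\<le>j. V ^ i) \<le> 2 * V ^ j"
proof (induction j)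
  case (Suc j)
  have "2 * V ^ j \<le> V * V ^ j" using assms by (rule mult_right_mono) simp
  then show ?case using Suc.IH by (simp only: sum.atMost_Suc power_Suc)
qed simp

text \<open>At least half of the sets must have size of order \<open>log (card X) / log (card U)\<close>, since there
  are few smaller ones.\<close>

lemma sum_card_distinct_sets_ge:
  assumes X: "finite X" "2 \<le> card X" and U: "finite U" "4 \<le> card U"
    and g: "inj_on g X" "\<And>x. x \<in> X \<Longrightarrow> g x \<subseteq> U"
  shows "real (card X) * log 2 (real (card X)) / (4 * log 2 (real (card U)))
    \<le> real (\<Sum>x\<in>X. card (g x))"
proof -
  define N V where "N = card X" and "V = card U"
  \<comment> \<open>\<open>T j\<close> bounds the number of subsets of \<open>U\<close> with at most
    \<open>j\<close> elements.\<close>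
  define T where "T j = (\<Sum>i\<le>j. V ^ i)" for j
  have T_ge: "j \<le> T j" for j
  proof -
    have "(\<Sum>i\<le>j. 1) \<le> T j" unfolding T_def using U by (intro sum_mono) (simp add: V_def)
    then show ?thesis by simp
  qed
  \<comment> \<open>The largest \<open>j\<close> for which the sets of size at most \<open>j\<close>
    can serve no more than half of \<open>X\<close>. Maximality, \<open>N < 2 * T (Suc j)\<close>,
    keeps \<open>j\<close> from being small.\<close>
  define j where "j = (LEAST j. N < 2 * T (Suc j))"
  have ex: "N < 2 * T (Suc N)" using T_ge[of "Suc N"] by simp
  have gt: "N < 2 * T (Suc j)" unfolding j_def by (rule LeastI[of _ N]) (rule ex)
  have le: "2 * T j \<le> N"
  proof (cases j)
    case 0
    then show ?thesis using X by (simp add: T_def N_def)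
  next
    case (Suc i)
    then show ?thesis using not_less_Least[of i "\<lambda>j. N < 2 * T (Suc j)"] by (simp add: j_def)
  qed
  have "N < 4 * V ^ Suc j" using gt sum_powers_le[of V "Suc j"] U by (simp add: T_def V_def)
  then have "real N < real (4 * V ^ Suc j)" by (subst of_nat_less_iff)
  then have "real N < 4 * real V ^ Suc j" by simp
  then have "log 2 (real N) \<le> log 2 (4 * real V ^ Suc j)"
    using X U by (subst log_le_cancel_iff) (auto simp: N_def V_def)
  also have "\<dots> = 2 + real (Suc j) * log 2 (real V)"
  proof -
    have "log 2 (4::real) = 2" using log_pow_cancel[of "2::real" 2] by simp
    moreover have "log 2 (real V ^ Suc j) = real (Suc j) * log 2 (real V)"
      by (rule log_nat_power) (use U in \<open>auto simp: V_def\<close>)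
    moreover have "real V ^ Suc j \<noteq> 0" using U by (auto simp: V_def)
    ultimately show ?thesis by (simp only: log_mult) simp
  qed
  \<comment> \<open>Since \<open>U\<close> has at least 4 elements, the additive 2 is absorbed by
    doubling; this and the halving of \<open>X\<close> make up the constant 4.\<close>
  also have "\<dots> \<le> 2 * (real (Suc j) * log 2 (real V))"
  proof -
    have "log 2 4 \<le> log 2 (real V)" using U by (simp add: V_def)
    moreover have "log 2 (4::real) = 2" using log_pow_cancel[of "2::real" 2] by simp
    ultimately have L: "2 \<le> log 2 (real V)" by simp
    then have "1 * log 2 (real V) \<le> real (Suc j) * log 2 (real V)" by (intro mult_right_mono) auto
    then show ?thesis using L unfolding mult_1 by linarith
  qed
  finally have j: "log 2 (real N) \<le> 2 * real (Suc j) * log 2 (real V)" by (simp only: mult.assoc)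
  define Y where "Y = {x \<in> X. card (g x) \<le> j}"
  have Y: "Y \<subseteq> X" by (auto simp: Y_def)
  have "card Y = card (g ` Y)" using g(1) Y by (metis card_image inj_on_subset)
  also have "\<dots> \<le> card {S. S \<subseteq> U \<and> card S \<le> j}"
    using g(2) U by (intro card_mono) (auto simp: Y_def)
  also have "\<dots> \<le> T j" unfolding T_def V_def by (rule card_small_subsets_le[OF U(1)])
  \<comment> \<open>At least half of \<open>X\<close> lies outside \<open>Y\<close>, and each
    element there contributes at least \<open>Suc j\<close>.\<close>
  finally have "N \<le> 2 * card (X - Y)"
    using le card_Diff_subset[OF finite_subset[OF Y X(1)] Y] by (simp add: N_def)
  then have "Suc j * N \<le> 2 * (Suc j * card (X - Y))" by (metis mult.left_commute mult_le_mono2)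
  also have "Suc j * card (X - Y) = (\<Sum>x\<in>X - Y. Suc j)" by simp
  also have "\<dots> \<le> (\<Sum>x\<in>X - Y. card (g x))" by (rule sum_mono) (auto simp: Y_def)
  also have "\<dots> \<le> (\<Sum>x\<in>X. card (g x))" using X by (intro sum_mono2) auto
  finally have "real (Suc j * N) \<le> real (2 * (\<Sum>x\<in>X. card (g x)))"
    by (subst of_nat_le_iff) simp
  then have sum: "real (Suc j) * real N \<le> 2 * real (\<Sum>x\<in>X. card (g x))"
    by (simp only: of_nat_mult of_nat_numeral)
  have pos: "0 < log 2 (real V)" using U by (simp add: V_def)
  have "real N * log 2 (real N) \<le> real N * (2 * real (Suc j) * log 2 (real V))"
    using j by (intro mult_left_mono) auto
  also have "\<dots> = 2 * log 2 (real V) * (real (Suc j) * real N)" by simp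
  also have "\<dots> \<le> 2 * log 2 (real V) * (2 * real (\<Sum>x\<in>X. card (g x)))"
    using sum pos by (intro mult_left_mono) auto
  finally show ?thesis using pos by (simp add: N_def V_def field_simps)
qed


section \<open>The lower bound\<close>

text \<open>For each fixed prefix \<open>u\<close> and suffix \<open>v\<close> the codes of the
  \<open>q ^ l\<close> first halves are distinct, so the counting bound applies. The universe has
  logarithm \<open>2 * w\<close>, which turns the constant 4 into 8.\<close>

lemma sum_transfer_ge:
  assumes wf: "wf_algorithm w q A" and sol: "solves_convolution q (hard_vector n) A"
    and q: "2 \<le> q" and w: "0 < w" and n: "2 ^ k < n" and m: "b + 2 * 2 ^ k \<le> m"
  shows "real (q ^ m) * (2 ^ k * log 2 (real q) / (8 * real w))
    \<le> real (\<Sum>xs\<in>words q m. card (transfer A xs b (2 ^ k)))"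
proof -
  define l c where "l = (2::nat) ^ k" and "c = m - (b + l)"
  have m_eq: "m = b + (l + c)" and c: "2 ^ k \<le> c" using m by (auto simp: l_def c_def)
  define B where "B = real (q ^ l) * (real l * log 2 (real q) / (8 * real w))"
  have inner: "B \<le> real (\<Sum>x\<in>words q l. card (transfer A (u @ x @ v) b l))"
    if u: "u \<in> words q b" and v: "v \<in> words q c" for u v
  proof -
    define U where "U = {..<(2::nat) ^ w} \<times> {..<(2::nat) ^ w}"
    have cardU: "card U = 2 ^ (2 * w)" by (simp add: U_def mult_2 power_add)
    have "(2::nat) ^ 2 \<le> 2 ^ (2 * w)" using w by (intro power_increasing) auto
    then have U4: "4 \<le> card U" using cardU by simp
    have "(2::nat) ^ 1 \<le> q ^ l"
      using q one_le_power[of q] power_increasing[of 1 l q] by (simp add: l_def)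
    then have "real (card (words q l)) * log 2 (real (card (words q l))) / (4 * log 2 (real (card U)))
      \<le> real (\<Sum>x\<in>words q l. card (transfer_code A (u @ x @ v) b l))"
      using U4 transfer_code_inj[OF sol u v c n]
    proof (intro sum_card_distinct_sets_ge, goal_cases)
      case (6 x)
      then have "u @ x @ v \<in> words q m" unfolding m_eq using u v by (intro words_append)
      then show ?case unfolding U_def using m by (intro transfer_code_subset[OF wf]) (auto simp: l_def)
    qed (auto simp: U_def l_def)
    also have "\<dots> \<le> real (\<Sum>x\<in>words q l. card (transfer A (u @ x @ v) b l))"
      by (intro of_nat_mono sum_mono card_transfer_code_le)
    also have "real (card (words q l)) * log 2 (real (card (words q l))) / (4 * log 2 (real (card U))) = B"
      using q by (simp add: B_def cardU log_nat_power)
    finally show ?thesis .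
  qed
  have "real (q ^ m) * (2 ^ k * log 2 (real q) / (8 * real w)) =
      (\<Sum>u\<in>words q b. \<Sum>v\<in>words q c. B)"
    by (simp add: B_def m_eq power_add l_def)
  also have "\<dots> \<le> (\<Sum>u\<in>words q b. \<Sum>v\<in>words q c.
      real (\<Sum>x\<in>words q l. card (transfer A (u @ x @ v) b l)))"
    by (intro sum_mono inner)
  also have "\<dots> = real (\<Sum>u\<in>words q b. \<Sum>x\<in>words q l. \<Sum>v\<in>words q c.
      card (transfer A (u @ x @ v) b l))"
    by (subst sum.swap[of _ "words q c"]) simp
  also have "\<dots> = real (\<Sum>xs\<in>words q m. card (transfer A xs b (2 ^ k)))"
    by (simp add: m_eq sum_words_append l_def)
  finally show ?thesis .
qed

text \<open>Each of the \<open>K\<close> lengths contributes the same amount, since shorter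
  intervals transfer less but are proportionally more numerous.\<close>

lemma sum_probes_ge:
  assumes wf: "wf_algorithm w q A" and sol: "solves_convolution q (hard_vector n) A"
    and q: "2 \<le> q" and w: "0 < w" and n: "2 ^ K \<le> n" and m: "n \<le> m"
  shows "real (q ^ m) * (real m * (real K * log 2 (real q) / (32 * real w)))
    \<le> real (\<Sum>xs\<in>words q m. probes A xs)"
proof -
  define L where "L = log 2 (real q) / (32 * real w)"
  have L: "0 \<le> L" using q by (simp add: L_def)
  have level: "real (q ^ m) * (real m * L) \<le>
      (\<Sum>i<m div 2 ^ Suc k. real (\<Sum>xs\<in>words q m. card (transfer A xs (i * 2 ^ Suc k) (2 ^ k))))"
    if k: "k < K" for k
  proof -
    define d where "d = m div 2 ^ Suc k"
    have "(2::nat) ^ Suc k \<le> 2 ^ K" using k by (intro power_increasing) auto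
    then have kn: "2 ^ Suc k \<le> n" using n by linarith
    then have d1: "1 \<le> d" using m by (simp add: d_def div_greater_zero_iff Suc_le_eq)
    have "m < Suc d * 2 ^ Suc k" unfolding d_def
      using dividend_less_div_times[of "2 ^ Suc k" m] by simp
    \<comment> \<open>As at least one complete interval fits, the incomplete remainder costs only a
      factor 2. Hence \<open>m\<close> is at most \<open>4 * d * 2 ^ k\<close>, and 8 becomes
      32.\<close>
    also have "\<dots> \<le> (2 * d) * 2 ^ Suc k" using d1 by (intro mult_right_mono) auto
    finally have "real m \<le> real ((2 * d) * 2 ^ Suc k)" by (subst of_nat_le_iff) simp
    then have dm: "real m \<le> 4 * real d * 2 ^ k" by simp
    have "real (q ^ m) * (real m * L) \<le> real (q ^ m) * (4 * real d * 2 ^ k * L)"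
      using dm L by (intro mult_left_mono mult_right_mono) auto
    also have "\<dots> = (\<Sum>i<d. real (q ^ m) * (2 ^ k * log 2 (real q) / (8 * real w)))"
      by (simp add: L_def)
    also have "\<dots> \<le> (\<Sum>i<d. real (\<Sum>xs\<in>words q m. card (transfer A xs (i * 2 ^ Suc k) (2 ^ k))))"
    proof (intro sum_mono sum_transfer_ge[OF wf sol q w])
      show "2 ^ k < n" using kn by (meson less_le_trans lessI one_less_numeral_iff power_strict_increasing semiring_norm(76))
      fix i assume "i \<in> {..<d}"
      then have "Suc i \<le> d" by simp
      then have "Suc i * 2 ^ Suc k \<le> m"
        unfolding d_def by (metis div_times_less_eq_dividend le_trans mult_le_mono1)
      then show "i * 2 ^ Suc k + 2 * 2 ^ k \<le> m" by simp
    qed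
    finally show ?thesis by (simp add: d_def)
  qed
  have "real (q ^ m) * (real m * (real K * log 2 (real q) / (32 * real w))) =
      (\<Sum>k<K. real (q ^ m) * (real m * L))"
    by (simp add: L_def)
  also have "\<dots> \<le> (\<Sum>k<K. \<Sum>i<m div 2 ^ Suc k.
      real (\<Sum>xs\<in>words q m. card (transfer A xs (i * 2 ^ Suc k) (2 ^ k))))"
    by (intro sum_mono level) simp
  also have "\<dots> = real (\<Sum>k<K. \<Sum>i<m div 2 ^ Suc k. \<Sum>xs\<in>words q m.
      card (transfer A xs (i * 2 ^ Suc k) (2 ^ k)))" by simp
  also have "\<dots> = real (\<Sum>xs\<in>words q m. \<Sum>k<K. \<Sum>i<m div 2 ^ Suc k.
      card (transfer A xs (i * 2 ^ Suc k) (2 ^ k)))"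
    by (subst sum.swap[of _ "words q m"], subst sum.swap[of _ "words q m"]) simp
  also have "\<dots> \<le> real (\<Sum>xs\<in>words q m. probes A xs)"
    by (intro of_nat_mono sum_mono sum_card_transfer_le_probes) (simp add: words_def)
  finally show ?thesis .
qed

text \<open>The easy direction of Yao's principle: the bound on the sum over all streams holds
  almost surely, hence in expectation, so not every stream can have a smaller expectation.\<close>

lemma exists_expensive_word:
  assumes M: "randomised_algorithm w q M" and sol: "AE A in M. solves_convolution q F A"
    and q: "0 < q" and m: "0 < m"
    and bound: "\<And>A. wf_algorithm w q A \<Longrightarrow> solves_convolution q F A \<Longrightarrow>
      real (q ^ m) * (real m * r) \<le> real (\<Sum>xs\<in>words q m. probes A xs)"
  shows "\<exists>xs\<in>words q m. ennreal r \<le> expected_amortised_time M xs"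
proof (rule ccontr)
  assume "\<not> ?thesis"
  then have less: "expected_amortised_time M xs < ennreal r" if "xs \<in> words q m" for xs
    using that by auto
  \<comment> \<open>\<open>ennreal\<close> maps nonpositive reals to 0, below which no time lies;
    the zero stream serves as the word needed here.\<close>
  have r: "0 < r" using less[of "replicate m 0"] q m by (cases "0 < r") (auto simp: words_def ennreal_neg)
  interpret prob_space M using M by (simp add: randomised_algorithm_def)
  have meas: "(\<lambda>A. of_nat (probes A xs) :: ennreal) \<in> borel_measurable M" if "xs \<in> words q m" for xs
    by (rule measurable_compose[where N = "count_space UNIV"])
       (use M that in \<open>auto simp: randomised_algorithm_def words_def\<close>)
  have lt: "(\<integral>\<^sup>+ A. of_nat (probes A xs) \<partial>M) < ennreal (real m * r)" if xs: "xs \<in> words q m" for xs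
  proof -
    have "(\<integral>\<^sup>+ A. of_nat (probes A xs) \<partial>M) / of_nat m < ennreal r"
      using less[OF xs] xs by (simp add: expected_amortised_time_def words_def)
    then have "(\<integral>\<^sup>+ A. of_nat (probes A xs) \<partial>M) < ennreal r * of_nat m"
      using m by (subst (asm) divide_less_ennreal) (auto simp: of_nat_less_top)
    then show ?thesis using r by (simp add: ennreal_mult' ennreal_of_nat_eq_real_of_nat mult.commute)
  qed
  have "ennreal (real (q ^ m) * (real m * r)) =
      (\<integral>\<^sup>+ A. ennreal (real (q ^ m) * (real m * r)) \<partial>M)" by (simp add: emeasure_space_1)
  also have "\<dots> \<le> (\<integral>\<^sup>+ A. (\<Sum>xs\<in>words q m. of_nat (probes A xs)) \<partial>M)"
  proof (rule nn_integral_mono_AE)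
    show "AE A in M. ennreal (real (q ^ m) * (real m * r)) \<le> (\<Sum>xs\<in>words q m. of_nat (probes A xs))"
      using sol AE_space
    proof eventually_elim
      case (elim A)
      then have "wf_algorithm w q A" using M by (simp add: randomised_algorithm_def)
      from ennreal_leI[OF bound[OF this elim(1)]]
      show ?case by (simp add: ennreal_of_nat_eq_real_of_nat flip: of_nat_sum)
    qed
  qed
  also have "\<dots> = (\<Sum>xs\<in>words q m. \<integral>\<^sup>+ A. of_nat (probes A xs) \<partial>M)"
    using meas by (rule nn_integral_sum)
  \<comment> \<open>All expectations are finite, so the strict comparison of the sums can be made in
    the reals.\<close>
  also have "\<dots> = (\<Sum>xs\<in>words q m. ennreal (enn2real (\<integral>\<^sup>+ A. of_nat (probes A xs) \<partial>M)))"
    using lt by (intro sum.cong refl) (metis ennreal_enn2real ennreal_less_top less_trans)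
  also have "\<dots> = ennreal (\<Sum>xs\<in>words q m. enn2real (\<integral>\<^sup>+ A. of_nat (probes A xs) \<partial>M))"
    by (intro sum_ennreal enn2real_nonneg)
  also have "\<dots> < ennreal (\<Sum>xs\<in>words q m. real m * r)"
  proof (rule ennreal_lessI)
    have ne: "words q m \<noteq> {}" using q card_words[of q m] by (metis card.empty power_not_zero less_irrefl)
    show "0 < (\<Sum>xs\<in>words q m. real m * r)" using q r m by simp
    show "(\<Sum>xs\<in>words q m. enn2real (\<integral>\<^sup>+ A. of_nat (probes A xs) \<partial>M)) <
        (\<Sum>xs\<in>words q m. real m * r)"
    proof (rule sum_strict_mono[OF finite_words ne])
      fix xs assume "xs \<in> words q m"
      from lt[OF this] show "enn2real (\<integral>\<^sup>+ A. of_nat (probes A xs) \<partial>M) < real m * r"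
        by (metis enn2real_nonneg ennreal_enn2real ennreal_less_iff ennreal_less_top less_trans)
    qed
  qed
  also have "\<dots> = ennreal (real (q ^ m) * (real m * r))" by simp
  finally show False by simp
qed

theorem theorem1:
  fixes \<kappa> :: real
  assumes "\<kappa> > 0"
  shows "\<exists>c::real. c > 0 \<and>
    (\<forall>(q::nat) (n::nat) (w::nat) \<A>.
       q > 0 \<longrightarrow> n > 0 \<longrightarrow> w > 0 \<longrightarrow> real w \<ge> \<kappa> * log 2 (real n) \<longrightarrow>
       solves_online_convolution w q n \<A> \<longrightarrow>
       (\<exists>F\<in>words q n. \<forall>m\<ge>n. \<exists>xs\<in>words q m.
          expected_amortised_time (\<A> F) xs \<ge>
            ennreal (c * (real_of_int \<lceil>log 2 (real q)\<rceil> / real w * log 2 (real n)))))"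
proof (intro exI[of _ "1 / 128"] conjI allI impI)
  fix q n w :: nat and \<A>
  assume q: "0 < q" and n: "0 < n" and w: "0 < w" and sol: "solves_online_convolution w q n \<A>"
  define r where "r = 1 / 128 * (real_of_int \<lceil>log 2 (real q)\<rceil> / real w * log 2 (real n))"
  show "\<exists>F\<in>words q n. \<forall>m\<ge>n. \<exists>xs\<in>words q m. ennreal r \<le> expected_amortised_time (\<A> F) xs"
  proof (cases "q = 1 \<or> n = 1")
    case True
    \<comment> \<open>One of the two logarithms vanishes, so any stream will do.\<close>
    then have "r = 0" by (auto simp: r_def)
    moreover have "replicate i 0 \<in> words q i" for i using q by (auto simp: words_def)
    ultimately show ?thesis by auto
  next
    case False
    then have q2: "2 \<le> q" and n2: "2 \<le> n" using q n by auto
    have F: "hard_vector n \<in> words q n" using q2 by (intro hard_vector_in_words) simp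
    define K where "K = nat \<lfloor>log 2 (real n)\<rfloor>"
    have logn: "1 \<le> log 2 (real n)" and logq: "1 \<le> log 2 (real q)" using n2 q2 by auto
    have K: "real K = of_int \<lfloor>log 2 (real n)\<rfloor>" using logn by (simp add: K_def)
    have "2 powr real K \<le> real n" using n K by (simp add: powr_le_iff)
    then have Kn: "2 ^ K \<le> n" by (simp add: powr_realpow)
    have "1 \<le> real K" using K logn by simp
    then have log2K: "log 2 (real n) \<le> 2 * real K" using K by linarith
    have ceil: "of_int \<lceil>log 2 (real q)\<rceil> \<le> 2 * log 2 (real q)" using logq by linarith
    \<comment> \<open>Rounding \<open>log 2 q\<close> up and \<open>log 2 n\<close> down costs a
      factor 2 each, which turns 32 into 128.\<close>
    have "of_int \<lceil>log 2 (real q)\<rceil> * log 2 (real n) \<le> (2 * log 2 (real q)) * (2 * real K)"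
      using log2K ceil logn logq by (intro mult_mono) auto
    then have r: "r \<le> real K * log 2 (real q) / (32 * real w)"
      using w by (simp add: r_def field_simps)
    have "\<exists>xs\<in>words q m. ennreal r \<le> expected_amortised_time (\<A> (hard_vector n)) xs" if m: "n \<le> m" for m
    proof (rule exists_expensive_word)
      fix A assume A: "wf_algorithm w q A" "solves_convolution q (hard_vector n) A"
      have "real (q ^ m) * (real m * r) \<le>
          real (q ^ m) * (real m * (real K * log 2 (real q) / (32 * real w)))"
        using r by (intro mult_left_mono) auto
      also have "\<dots> \<le> real (\<Sum>xs\<in>words q m. probes A xs)"
        by (rule sum_probes_ge[OF A q2 w Kn m])
      finally show "real (q ^ m) * (real m * r) \<le> real (\<Sum>xs\<in>words q m. probes A xs)" .
    qed (use sol F q n m in \<open>auto simp: solves_online_convolution_def\<close>)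
    then show ?thesis using F by blast
  qed
qed simp

end
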